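(* Let $(\Phi,M)$ be an incarnation of a data set $\Phi$ with domain $X$, let $\Phi/M$ be its quotient, and let $(\coprod_{\Psi\in\Phi/M}\Psi,M')$ be the diagonal incarnation. Let $T\colon M\to M'$ map $g$ to $\coprod_{\Psi\in\Phi/M}g$, and let $\alpha\colon\Phi\to\coprod_{\Psi\in\Phi/M}\Psi$ map $\phi$ to the function $\coprod_{\Psi\in\Phi/M}X\to\mathbf{R}$ whose restriction to the summand $X$ corresponding to the block $[\phi]$ containing $\phi$ is $\phi$ and which is $0$ on all other summands. Then the SEO $$(\alpha,T)\colon(\Phi,M)\to\Big(\coprod_{\Psi\in\Phi/M}\Psi,\,M'\Big)$$ is an isomorphism.
   Context: A data set is a finite set $\Phi=\{\phi_i\colon X\to\mathbf{R}\mid i=1,\dots,m\}$, $m\ge1$, of real-valued functions (measurements) on a finite set $X$, called its domain. $\mathrm{End}_\Phi(X)$ is the monoid of functions $g\colon X\to X$ such that $\phi g:=\phi\circ g\in\Phi$ for every $\phi\in\Phi$. An incarnation of $\Phi$ is a pair $(\Phi,M)$ with $M\subset\mathrm{End}_\Phi(X)$ a subset. A SEO (set equivariant operator) $(\alpha,T)\colon(\Phi,M)\to(\Psi,N)$ between incarnations is a pair of functions $\alpha\colon\Phi\to\Psi$ and $T\colon M\to N$ with $\alpha(\phi g)=\alpha(\phi)T(g)$ for all $\phi\in\Phi$, $g\in M$. SEOs compose componentwise and are the morphisms of a category whose objects are incarnations; isomorphism means isomorphism in this category. A SEO is an isomorphism if and only if both of its component functions are bijections. A measurement $\psi\in\Phi$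 is a deformation of $\phi\in\Phi$ if $\psi=\phi$ or $\psi=\phi g_1\cdots g_k$ for some $g_1,\dots,g_k\in M$. The quotient $\Phi/M$ is the partition of $\Phi$ into the classes (blocks) of the equivalence relation generated by the relation of being a deformation; $[\phi]$ denotes the block containing $\phi$. Each block is a data set with domain $X$. The coproduct data set $\coprod_{\Psi\in\Phi/M}\Psi$ has domain the disjoint union $\coprod_{\Psi\in\Phi/M}X$ (one copy of $X$ for each block) and consists of the functions $\coprod_{\Psi\in\Phi/M}X\to\mathbf{R}$ whose restriction to all but one of the summands $X$ is the $0$ function and whose restriction to the remaining summand belongs to the block corresponding to that summand. For $g\in M$, $\coprod_{\Psi\in\Phi/M}g\colon\coprod_{\Psi\in\Phi/M}X\to\coprod_{\Psi\in\Phi/M}X$ is the map acting as $g$ on each summand. Let $M'=\{\coprod_{\Psi\in\Phi/M}g\mid g\in M\}$, which is contained in $\mathrm{End}_{\coprod_{\Psi\in\Phi/M}\Psi}(\coprod_{\Psi\in\Phi/M}X)$; the pair $(\coprod_{\Psi\in\Phi/M}\Psi,M')$ is called the diagonal incarnation. *)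

theory Defs
  imports Complex_Main "HOL-Library.FuncSet"
begin

text \<open>
  Functions between sets are extensional (they are \<open>undefined\<close> off their domain), so that HOL equality
  is equality of functions on the given sets, and composites are formed with \<^const>\<open>compose\<close>.
  The domain of a data set may be empty.
\<close>

definition data_set :: "'a set \<Rightarrow> ('a \<Rightarrow> real) set \<Rightarrow> bool" where
  "data_set X \<Phi> \<longleftrightarrow> finite X \<and> finite \<Phi> \<and> \<Phi> \<noteq> {} \<and> \<Phi> \<subseteq> (X \<rightarrow>\<^sub>E UNIV)"

definition End_set :: "'a set \<Rightarrow> ('a \<Rightarrow> real) set \<Rightarrow> ('a \<Rightarrow> 'a) set" where
  "End_set X \<Phi> = {g \<in> X \<rightarrow>\<^sub>E X. \<forall>\<phi>\<in>\<Phi>. compose X \<phi> g \<in> \<Phi>}"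

record 'a incarnation =
  space :: "'a set"
  meas :: "('a \<Rightarrow> real) set"
  ops :: "('a \<Rightarrow> 'a) set"

definition is_incarnation :: "'a incarnation \<Rightarrow> bool" where
  "is_incarnation I \<longleftrightarrow> data_set (space I) (meas I) \<and> ops I \<subseteq> End_set (space I) (meas I)"


subsection \<open>The category of incarnations\<close>

type_synonym ('a, 'b) seo = "(('a \<Rightarrow> real) \<Rightarrow> ('b \<Rightarrow> real)) \<times> (('a \<Rightarrow> 'a) \<Rightarrow> ('b \<Rightarrow> 'b))"

definition is_seo :: "'a incarnation \<Rightarrow> 'b incarnation \<Rightarrow> ('a, 'b) seo \<Rightarrow> bool" where
  "is_seo I J = (\<lambda>(\<alpha>, T).
     is_incarnation I \<and> is_incarnation J \<and>
     \<alpha> \<in> meas I \<rightarrow>\<^sub>E meas J \<and> T \<in> ops I \<rightarrow>\<^sub>E ops J \<and>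
     (\<forall>\<phi>\<in>meas I. \<forall>g\<in>ops I. \<alpha> (compose (space I) \<phi> g) = compose (space J) (\<alpha> \<phi>) (T g)))"

definition seo_id :: "'a incarnation \<Rightarrow> ('a, 'a) seo" where
  "seo_id I = (\<lambda>\<phi>\<in>meas I. \<phi>, \<lambda>g\<in>ops I. g)"

text \<open>The composite \<open>G \<circ> F\<close>; the first argument is the source of \<open>F\<close>.\<close>

definition seo_comp :: "'a incarnation \<Rightarrow> ('b, 'c) seo \<Rightarrow> ('a, 'b) seo \<Rightarrow> ('a, 'c) seo" where
  "seo_comp I G F = (compose (meas I) (fst G) (fst F), compose (ops I) (snd G) (snd F))"

definition is_seo_iso :: "'a incarnation \<Rightarrow> 'b incarnation \<Rightarrow> ('a, 'b) seo \<Rightarrow> bool" where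
  "is_seo_iso I J F \<longleftrightarrow> is_seo I J F \<and>
     (\<exists>G. is_seo J I G \<and> seo_comp I G F = seo_id I \<and> seo_comp J F G = seo_id J)"


subsection \<open>The quotient of an incarnation\<close>

definition is_deformation :: "'a incarnation \<Rightarrow> ('a \<Rightarrow> real) \<Rightarrow> ('a \<Rightarrow> real) \<Rightarrow> bool" where
  "is_deformation I \<psi> \<phi> \<longleftrightarrow> \<phi> \<in> meas I \<and> \<psi> \<in> meas I \<and>
     (\<exists>gs. set gs \<subseteq> ops I \<and> \<psi> = foldl (compose (space I)) \<phi> gs)"

definition block_rel :: "'a incarnation \<Rightarrow> ('a \<Rightarrow> real) rel" where
  "block_rel I = {(\<phi>, \<psi>) \<in> meas I \<times> meas I. equivclp (is_deformation I) \<phi> \<psi>}"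

definition blocks :: "'a incarnation \<Rightarrow> ('a \<Rightarrow> real) set set" where
  "blocks I = meas I // block_rel I"

definition block :: "'a incarnation \<Rightarrow> ('a \<Rightarrow> real) \<Rightarrow> ('a \<Rightarrow> real) set" where
  "block I \<phi> = block_rel I `` {\<phi>}"


subsection \<open>The diagonal incarnation\<close>

text \<open>The point \<open>x\<close> of the copy of \<open>X\<close> belonging to the block \<open>\<Psi>\<close> is the pair \<open>(\<Psi>, x)\<close>.\<close>

definition coprod_space :: "'a incarnation \<Rightarrow> (('a \<Rightarrow> real) set \<times> 'a) set" where
  "coprod_space I = blocks I \<times> space I"

definition coprod_meas :: "'a incarnation \<Rightarrow> (('a \<Rightarrow> real) set \<times> 'a \<Rightarrow> real) set" where
  "coprod_meas I = {f \<in> coprod_space I \<rightarrow>\<^sub>E UNIV.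
     \<exists>\<Psi>\<in>blocks I. (\<lambda>x\<in>space I. f (\<Psi>, x)) \<in> \<Psi> \<and>
       (\<forall>\<Psi>'\<in>blocks I - {\<Psi>}. \<forall>x\<in>space I. f (\<Psi>', x) = 0)}"

definition coprod_map ::
  "'a incarnation \<Rightarrow> ('a \<Rightarrow> 'a) \<Rightarrow> (('a \<Rightarrow> real) set \<times> 'a \<Rightarrow> ('a \<Rightarrow> real) set \<times> 'a)" where
  "coprod_map I g = (\<lambda>(\<Psi>, x)\<in>coprod_space I. (\<Psi>, g x))"

definition diagonal :: "'a incarnation \<Rightarrow> (('a \<Rightarrow> real) set \<times> 'a) incarnation" where
  "diagonal I = \<lparr>space = coprod_space I, meas = coprod_meas I, ops = coprod_map I ` ops I\<rparr>"

definition diag_alpha ::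
  "'a incarnation \<Rightarrow> ('a \<Rightarrow> real) \<Rightarrow> (('a \<Rightarrow> real) set \<times> 'a \<Rightarrow> real)" where
  "diag_alpha I = (\<lambda>\<phi>\<in>meas I. \<lambda>(\<Psi>, x)\<in>coprod_space I. if \<Psi> = block I \<phi> then \<phi> x else 0)"

definition diag_T ::
  "'a incarnation \<Rightarrow> ('a \<Rightarrow> 'a) \<Rightarrow> (('a \<Rightarrow> real) set \<times> 'a \<Rightarrow> ('a \<Rightarrow> real) set \<times> 'a)" where
  "diag_T I = (\<lambda>g\<in>ops I. coprod_map I g)"

end

theory Submission
  imports Defs
begin

text \<open>
  Composing with an operator never leaves a block, so \<open>\<alpha>\<close> is equivariant. It is injective:
  a measurement can be read off its image on the copy of \<open>X\<close> indexed by its own block, and if two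
  measurements in different blocks have the same image, then both vanish identically.
\<close>

subsection \<open>Bijective SEOs are isomorphisms\<close>

lemma compose_inv_into_left:
  assumes "bij_betw f A B"
  shows "compose A (restrict (inv_into A f) B) f = (\<lambda>x\<in>A. x)"
  using assms by (auto simp: fun_eq_iff compose_def bij_betw_def)

lemma compose_inv_into_right:
  assumes "bij_betw f A B"
  shows "compose B f (restrict (inv_into A f) B) = (\<lambda>x\<in>B. x)"
  using assms by (auto simp: fun_eq_iff compose_def bij_betw_inv_into_right)

lemma inv_into_restrict_PiE:
  assumes "bij_betw f A B"
  shows "restrict (inv_into A f) B \<in> B \<rightarrow>\<^sub>E A"
  using bij_betw_apply[OF bij_betw_inv_into[OF assms]] by auto

lemma is_incarnation_compose_meas:
  assumes "is_incarnation I" "\<phi> \<in> meas I" "g \<in> ops I"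
  shows "compose (space I) \<phi> g \<in> meas I"
  using assms by (auto simp: is_incarnation_def End_set_def)

text \<open>The pair of inverse bijections is again a SEO: its equivariance follows by pulling the
  equivariance of (\<alpha>, T) back along the bijections. This reduces the proposition to a SEO
  whose two components are bijective.\<close>

lemma is_seo_iso_if_bij:
  assumes seo: "is_seo I J (\<alpha>, T)"
    and bij_\<alpha>: "bij_betw \<alpha> (meas I) (meas J)"
    and bij_T: "bij_betw T (ops I) (ops J)"
  shows "is_seo_iso I J (\<alpha>, T)"
proof -
  \<comment> \<open>Restricting the inverses makes them extensional, as morphisms must be.\<close>
  define \<beta> where "\<beta> = restrict (inv_into (meas I) \<alpha>) (meas J)"
  define S where "S = restrict (inv_into (ops I) T) (ops J)"
  have I: "is_incarnation I" and J: "is_incarnation J"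
    and eq: "\<And>\<phi> g. \<phi> \<in> meas I \<Longrightarrow> g \<in> ops I \<Longrightarrow>
      \<alpha> (compose (space I) \<phi> g) = compose (space J) (\<alpha> \<phi>) (T g)"
    using seo by (auto simp: is_seo_def)
  have \<beta>: "\<beta> \<in> meas J \<rightarrow>\<^sub>E meas I" and S: "S \<in> ops J \<rightarrow>\<^sub>E ops I"
    unfolding \<beta>_def S_def by (intro inv_into_restrict_PiE bij_\<alpha> bij_T)+
  have "\<beta> (compose (space J) \<psi> h) = compose (space I) (\<beta> \<psi>) (S h)"
    if "\<psi> \<in> meas J" "h \<in> ops J" for \<psi> h
  proof -
    have mem: "\<beta> \<psi> \<in> meas I" "S h \<in> ops I"
      using that \<beta> S by auto
    \<comment> \<open>Equivariance of (\<alpha>, T) at \<open>\<beta> \<psi>\<close> and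
      \<open>S h\<close>, where \<alpha> undoes \<beta> and T undoes S. Applying \<beta> to this
      identity gives the claim.\<close>
    have "compose (space J) \<psi> h = \<alpha> (compose (space I) (\<beta> \<psi>) (S h))"
      using eq[OF mem] that bij_\<alpha> bij_T by (simp add: \<beta>_def S_def bij_betw_inv_into_right)
    moreover have "compose (space I) (\<beta> \<psi>) (S h) \<in> meas I"
      by (rule is_incarnation_compose_meas[OF I mem])
    moreover have "compose (space J) \<psi> h \<in> meas J"
      by (rule is_incarnation_compose_meas[OF J that])
    ultimately show ?thesis
      using bij_\<alpha> by (simp add: \<beta>_def bij_betw_inv_into_left)
  qed
  then have "is_seo J I (\<beta>, S)"
    using I J \<beta> S by (simp add: is_seo_def)
  moreover have "seo_comp I (\<beta>, S) (\<alpha>, T) = seo_id I" "seo_comp J (\<alpha>, T) (\<beta>, S) = seo_id J"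
    unfolding seo_comp_def seo_id_def \<beta>_def S_def
    by (simp_all add: compose_inv_into_left compose_inv_into_right bij_\<alpha> bij_T)
  ultimately show ?thesis
    using seo unfolding is_seo_iso_def by blast
qed

subsection \<open>Blocks\<close>

lemma equiv_block_rel: "equiv (meas I) (block_rel I)"
  by (rule equivI)
    (auto simp: block_rel_def refl_on_def sym_def trans_def
      intro: equivclp_sym equivclp_trans)

lemma block_in_blocks: "\<phi> \<in> meas I \<Longrightarrow> block I \<phi> \<in> blocks I"
  by (simp add: block_def blocks_def quotientI)

lemma mem_block: "\<phi> \<in> meas I \<Longrightarrow> \<phi> \<in> block I \<phi>"
  unfolding block_def using equiv_class_self[OF equiv_block_rel] .

lemma blocks_subset_meas: "\<Psi> \<in> blocks I \<Longrightarrow> \<Psi> \<subseteq> meas I"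
  using in_quotient_imp_subset[OF equiv_block_rel] by (auto simp: blocks_def)

lemma block_eqI:
  assumes "\<Psi> \<in> blocks I" "\<phi> \<in> \<Psi>"
  shows "block I \<phi> = \<Psi>"
  using assms unfolding blocks_def block_def
  by (metis Image_singleton_iff equiv_block_rel equiv_class_eq quotientE)

text \<open>One operator gives a one-step deformation, with the list \<open>[g]\<close> as witness.
  Hence the images of \<phi> and of \<phi>g under \<open>diag_alpha\<close> live on the same copy of
  X.\<close>

lemma block_compose:
  assumes "is_incarnation I" "\<phi> \<in> meas I" "g \<in> ops I"
  shows "block I (compose (space I) \<phi> g) = block I \<phi>"
proof -
  let ?\<psi> = "compose (space I) \<phi> g"
  have "?\<psi> \<in> meas I"
    using assms by (rule is_incarnation_compose_meas)
  moreover have "?\<psi> = foldl (compose (space I)) \<phi> [g]" "set [g] \<subseteq> ops I"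
    using assms by auto
  ultimately have "is_deformation I ?\<psi> \<phi>"
    unfolding is_deformation_def using assms by blast
  then have "(?\<psi>, \<phi>) \<in> block_rel I"
    using assms \<open>?\<psi> \<in> meas I\<close> by (simp add: block_rel_def r_into_equivclp)
  then show ?thesis
    unfolding block_def by (rule equiv_class_eq[OF equiv_block_rel])
qed

subsection \<open>The diagonal incarnation\<close>

lemma diagonal_simps [simp]:
  "space (diagonal I) = coprod_space I"
  "meas (diagonal I) = coprod_meas I"
  "ops (diagonal I) = coprod_map I ` ops I"
  by (simp_all add: diagonal_def)

lemma diag_alpha_apply:
  assumes "\<phi> \<in> meas I" "\<Psi> \<in> blocks I" "x \<in> space I"
  shows "diag_alpha I \<phi> (\<Psi>, x) = (if \<Psi> = block I \<phi> then \<phi> x else 0)"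
  using assms by (simp add: diag_alpha_def coprod_space_def)

lemma diag_alpha_extensional:
  "\<phi> \<in> meas I \<Longrightarrow> diag_alpha I \<phi> \<in> extensional (coprod_space I)"
  by (simp add: diag_alpha_def)

lemma coprod_map_apply:
  "\<Psi> \<in> blocks I \<Longrightarrow> x \<in> space I \<Longrightarrow> coprod_map I g (\<Psi>, x) = (\<Psi>, g x)"
  by (simp add: coprod_map_def coprod_space_def)

context
  fixes I :: "'a incarnation"
  assumes I: "is_incarnation I"
begin

lemma meas_extensional: "\<phi> \<in> meas I \<Longrightarrow> \<phi> \<in> extensional (space I)"
  using I by (auto simp: is_incarnation_def data_set_def PiE_def)

lemma ops_PiE: "g \<in> ops I \<Longrightarrow> g \<in> space I \<rightarrow>\<^sub>E space I"
  using I by (auto simp: is_incarnation_def End_set_def)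

text \<open>Since \<phi> is extensional, the agreement on \<open>space I\<close> is an equality of
  HOL functions. It shows that the image of \<phi> restricts to a member of the block of
  \<phi>.\<close>

lemma diag_alpha_restrict:
  assumes "\<phi> \<in> meas I"
  shows "(\<lambda>x\<in>space I. diag_alpha I \<phi> (block I \<phi>, x)) = \<phi>"
  using assms meas_extensional[OF assms]
  by (intro extensionalityI[of _ "space I"]) (auto simp: diag_alpha_apply block_in_blocks)

lemma diag_alpha_in_coprod_meas:
  assumes "\<phi> \<in> meas I"
  shows "diag_alpha I \<phi> \<in> coprod_meas I"
  unfolding coprod_meas_def
proof (intro CollectI conjI bexI)
  show "diag_alpha I \<phi> \<in> coprod_space I \<rightarrow>\<^sub>E UNIV"
    using diag_alpha_extensional[OF assms] by (simp add: PiE_def)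
  show "(\<lambda>x\<in>space I. diag_alpha I \<phi> (block I \<phi>, x)) \<in> block I \<phi>"
    by (simp only: diag_alpha_restrict[OF assms] mem_block[OF assms])
  show "\<forall>\<Psi>'\<in>blocks I - {block I \<phi>}. \<forall>x\<in>space I. diag_alpha I \<phi> (\<Psi>', x) = 0"
    using assms by (simp add: diag_alpha_apply)
qed (rule block_in_blocks[OF assms])

text \<open>Surjectivity of \<alpha>: the preimage of f is its restriction \<phi> to the
  distinguished copy \<Psi>. As \<phi> lies in \<Psi>, its block is \<Psi>, so \<alpha> puts \<phi>
  back on that copy.\<close>

lemma coprod_meas_eq_image: "coprod_meas I = diag_alpha I ` meas I"
proof (intro subset_antisym subsetI)
  fix f assume f: "f \<in> coprod_meas I"
  then obtain \<Psi> where \<Psi>: "\<Psi> \<in> blocks I" "(\<lambda>x\<in>space I. f (\<Psi>, x)) \<in> \<Psi>"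
    and zero: "\<And>\<Psi>' x. \<Psi>' \<in> blocks I \<Longrightarrow> \<Psi>' \<noteq> \<Psi> \<Longrightarrow> x \<in> space I \<Longrightarrow> f (\<Psi>', x) = 0"
    by (auto simp: coprod_meas_def)
  define \<phi> where "\<phi> = (\<lambda>x\<in>space I. f (\<Psi>, x))"
  have \<phi>: "\<phi> \<in> meas I"
    using blocks_subset_meas[OF \<Psi>(1)] \<Psi>(2) by (auto simp: \<phi>_def)
  have block: "block I \<phi> = \<Psi>"
    using block_eqI[OF \<Psi>] by (simp add: \<phi>_def)
  have "f = diag_alpha I \<phi>"
  proof (rule extensionalityI[of _ "coprod_space I"])
    show "f \<in> extensional (coprod_space I)"
      using f by (auto simp: coprod_meas_def PiE_def)
    show "diag_alpha I \<phi> \<in> extensional (coprod_space I)"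
      using \<phi> by (rule diag_alpha_extensional)
    fix p assume "p \<in> coprod_space I"
    then obtain \<Psi>' x where "p = (\<Psi>', x)" "\<Psi>' \<in> blocks I" "x \<in> space I"
      by (auto simp: coprod_space_def)
    \<comment> \<open>On the other copies both sides are 0. On the copy \<Psi> the definition of
      \<phi> remains; it is unfolded last, because the facts used first mention \<phi>
      itself.\<close>
    then show "f p = diag_alpha I \<phi> p"
      using zero by (simp add: diag_alpha_apply \<phi> block) (simp add: \<phi>_def)
  qed
  then show "f \<in> diag_alpha I ` meas I"
    using \<phi> by blast
qed (auto simp: diag_alpha_in_coprod_meas)

lemma inj_on_diag_alpha: "inj_on (diag_alpha I) (meas I)"
proof (rule inj_onI)
  fix \<phi> \<psi> assume \<phi>: "\<phi> \<in> meas I" and \<psi>: "\<psi> \<in> meas I"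
    and eq: "diag_alpha I \<phi> = diag_alpha I \<psi>"
  show "\<phi> = \<psi>"
  proof (rule extensionalityI[of _ "space I"])
    fix x assume x: "x \<in> space I"
    show "\<phi> x = \<psi> x"
      \<comment> \<open>If the blocks agree, either evaluation gives the equality. Otherwise the
        first forces \<open>\<phi> x = 0\<close> and the second \<open>\<psi> x = 0\<close>.\<close>
      using fun_cong[OF eq, of "(block I \<phi>, x)"] fun_cong[OF eq, of "(block I \<psi>, x)"]
      by (auto simp: diag_alpha_apply \<phi> \<psi> x block_in_blocks split: if_splits)
  qed (use \<phi> \<psi> meas_extensional in auto)
qed

text \<open>At \<open>(\<Psi>, x)\<close> both sides are \<open>\<phi> (g x)\<close> or 0 according
  to whether \<Psi> is the block of \<phi>, which is also the block of \<phi>g.\<close>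

lemma diag_alpha_compose:
  assumes \<phi>: "\<phi> \<in> meas I" and g: "g \<in> ops I"
  shows "diag_alpha I (compose (space I) \<phi> g) =
    compose (coprod_space I) (diag_alpha I \<phi>) (coprod_map I g)"
proof (rule extensionalityI[of _ "coprod_space I"])
  have \<phi>g: "compose (space I) \<phi> g \<in> meas I"
    using I \<phi> g by (rule is_incarnation_compose_meas)
  then show "diag_alpha I (compose (space I) \<phi> g) \<in> extensional (coprod_space I)"
    by (rule diag_alpha_extensional)
  fix p assume p: "p \<in> coprod_space I"
  then obtain \<Psi> x where \<Psi>: "p = (\<Psi>, x)" "\<Psi> \<in> blocks I" "x \<in> space I"
    by (auto simp: coprod_space_def)
  \<comment> \<open>This keeps \<open>(\<Psi>, g x)\<close> in the coproduct, where the value of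
    \<open>diag_alpha\<close> is given by its formula.\<close>
  moreover have "g x \<in> space I"
    using ops_PiE[OF g] \<Psi> by auto
  ultimately show "diag_alpha I (compose (space I) \<phi> g) p =
      compose (coprod_space I) (diag_alpha I \<phi>) (coprod_map I g) p"
    using p \<phi> \<phi>g
    by (simp add: compose_eq coprod_map_apply diag_alpha_apply block_compose[OF I \<phi> g])
qed simp

lemma inj_on_coprod_map: "inj_on (coprod_map I) (ops I)"
proof (rule inj_onI)
  fix g h assume g: "g \<in> ops I" and h: "h \<in> ops I" and eq: "coprod_map I g = coprod_map I h"
  \<comment> \<open>A data set is nonempty, so there is at least one copy of X on which g can be
    read off.\<close>
  obtain \<phi> where "\<phi> \<in> meas I"
    using I by (auto simp: is_incarnation_def data_set_def)
  then have \<Psi>: "block I \<phi> \<in> blocks I"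
    by (rule block_in_blocks)
  show "g = h"
  proof (rule PiE_ext[OF ops_PiE[OF g] ops_PiE[OF h]])
    fix x assume "x \<in> space I"
    then show "g x = h x"
      using fun_cong[OF eq, of "(block I \<phi>, x)"] by (simp add: coprod_map_apply \<Psi>)
  qed
qed

lemma finite_coprod_space: "finite (coprod_space I)"
proof -
  have "finite (blocks I)"
    using I unfolding blocks_def is_incarnation_def data_set_def
    by (intro finite_quotient) (auto simp: block_rel_def)
  then show ?thesis
    using I by (simp add: coprod_space_def is_incarnation_def data_set_def)
qed

text \<open>Finiteness and nonemptiness pass to the image of \<alpha>. Closure under the diagonal
  operators is the equivariance identity read from right to left: composing \<alpha>(\<phi>) with
  the coproduct of g gives \<alpha>(\<phi>g).\<close>

lemma is_incarnation_diagonal: "is_incarnation (diagonal I)"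
proof -
  have "data_set (coprod_space I) (coprod_meas I)"
    using I finite_coprod_space
    by (auto simp: data_set_def coprod_meas_eq_image is_incarnation_def diag_alpha_extensional PiE_def)
  moreover have "coprod_map I g \<in> End_set (coprod_space I) (coprod_meas I)" if g: "g \<in> ops I" for g
  proof -
    have "coprod_map I g \<in> coprod_space I \<rightarrow>\<^sub>E coprod_space I"
      using ops_PiE[OF g] by (auto simp: coprod_map_def coprod_space_def)
    then show ?thesis
      using is_incarnation_compose_meas[OF I _ g] diag_alpha_compose[OF _ g, symmetric]
      by (auto simp: End_set_def coprod_meas_eq_image)
  qed
  ultimately show ?thesis
    by (auto simp: is_incarnation_def)
qed

lemma is_seo_diag: "is_seo I (diagonal I) (diag_alpha I, diag_T I)"
proof -
  have "diag_alpha I \<in> meas I \<rightarrow>\<^sub>E coprod_meas I"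
    by (intro PiE_I diag_alpha_in_coprod_meas) (simp_all add: diag_alpha_def)
  moreover have "diag_T I \<in> ops I \<rightarrow>\<^sub>E coprod_map I ` ops I"
    by (auto simp: diag_T_def)
  ultimately show ?thesis
    using I is_incarnation_diagonal diag_alpha_compose
    by (simp add: is_seo_def) (simp add: diag_T_def)
qed

end

theorem proposition6:
  fixes I :: "'a incarnation"
  assumes "is_incarnation I"
  shows "is_seo_iso I (diagonal I) (diag_alpha I, diag_T I)"
proof (rule is_seo_iso_if_bij)
  show "is_seo I (diagonal I) (diag_alpha I, diag_T I)"
    using assms by (rule is_seo_diag)
  show "bij_betw (diag_alpha I) (meas I) (meas (diagonal I))"
    using inj_on_diag_alpha[OF assms] coprod_meas_eq_image[OF assms] by (simp add: bij_betw_def)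
  show "bij_betw (diag_T I) (ops I) (ops (diagonal I))"
    using inj_on_coprod_map[OF assms] by (simp add: bij_betw_def diag_T_def inj_on_def)
qed

end
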